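(* For every integer $k\ge5$, the fundamental group of the $k$-cycle $C_k$ satisfies $(A_1(C_k,[0]),\cdot)\cong(\mathbb{Z},+)$.
   Context: Graphs: every graph $X$ is a simple graph (possibly infinite) with a loop attached at every vertex, with vertex set $V(X)$ and edge set $E(X)$; every vertex is adjacent to itself. A graph homomorphism $f:X\to Y$ is a map $V(X)\to V(Y)$ with $f(u)f(v)\in E(Y)$ whenever $uv\in E(X)$. $C_k$ is the $k$-cycle with vertices $[0],[1],\dots,[k-1]$, where $[i]$ and $[j]$ are adjacent iff $i-j\equiv0,1,-1\pmod k$. Stable homomorphisms: $I_\infty$ is the graph with vertex set $\mathbb{Z}$ in which $i,j$ are adjacent iff $|i-j|\le1$. $I_\infty^2$ is the graph on $\mathbb{Z}^2$ in which $(a,b),(a',b')$ are adjacent iff ($a=a'$ and $|b-b'|\le1$) or ($b=b'$ and $|a-a'|\le1$). A graph homomorphism $f:I_\infty^n\to X$ ($n=1,2$) stabilizes in direction $+i$ if there is an integer $p$ such that, for all values of the other coordinates, the value of $f$ with $i$-th coordinate $m$ equals that with $i$-th coordinate $p$ for all $m\ge p$; it stabilizes in direction $-i$ if there is an integer $q$ with the same property for all $m\le q$. $p_f^i$ is the least such $p$ and $n_f^i$ the greatest such $q$ (if $f$ does not depend on the $i$-th coordinate, $p_f^i=n_f^i=0$). $f$ is stable if it stabilizes in all directions; $S_n(X)$ is the set of stable graph homomorphisms $I_\infty^n\to X$. Fundamental group: $f,g\in S_1(X)$ are path homotopic, $f\sim g$, if there is $H\in S_2(X)$ such that (a) $f(p_f^1)=g(p_g^1)$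 and $f(n_f^1)=g(n_g^1)$; (b) $H(p_H^1,j)=f(p_f^1)$ and $H(n_H^1,j)=f(n_f^1)$ for all $j\in\mathbb{Z}$; (c) $H(j,n_H^2)=f(j)$ and $H(j,p_H^2)=g(j)$ for all $j\in\mathbb{Z}$. This is an equivalence relation. $B_1(X,x_0)$ is the set of $f\in S_1(X)$ with $f(n_f^1)=f(p_f^1)=x_0$, and $A_1(X,x_0)=B_1(X,x_0)/\sim$. For $f,g\in S_1(X)$ with $f(n_f^1)=g(p_g^1)$, the concatenation $f\cdot g$ is $(f\cdot g)(i)=f(i+n_f^1)$ for $i\ge0$ and $(f\cdot g)(i)=g(i+p_g^1)$ for $i\le0$. $A_1(X,x_0)$ is a group under $[f]\cdot[g]=[f\cdot g]$; its identity is the class of the constant map at $x_0$ and the inverse of $[\gamma]$ is $[\overline\gamma]$, where $\overline\gamma(i)=\gamma(-i)$. *)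

theory Defs
  imports
    "Graph_Theory.Pair_Digraph"
    "HOL-Number_Theory.Cong"
    "HOL-Algebra.Elementary_Groups"
begin

text \<open>
  Undirected edges are represented by a symmetric set of ordered pairs.
\<close>

locale reflexive_graph = pair_wf_digraph X for X :: "'a pair_pre_digraph" +
  assumes loops: "refl_on (pverts X) (parcs X)"
    and undirected: "sym (parcs X)"

definition graph_homs ::
    "'a pair_pre_digraph \<Rightarrow> 'b pair_pre_digraph \<Rightarrow> ('a \<Rightarrow> 'b) set" where
  "graph_homs X Y =
    {f \<in> pverts X \<rightarrow> pverts Y. \<forall>u v. (u, v) \<in> parcs X \<longrightarrow> (f u, f v) \<in> parcs Y}"

definition cycle_graph :: "int \<Rightarrow> int pair_pre_digraph" where
  "cycle_graph k =
    \<lparr>pverts = {0..<k},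
     parcs = {(i, j). i \<in> {0..<k} \<and> j \<in> {0..<k} \<and>
       ([i - j = 0] (mod k) \<or> [i - j = 1] (mod k) \<or> [i - j = -1] (mod k))}\<rparr>"

definition I_inf :: "int pair_pre_digraph" where
  "I_inf = \<lparr>pverts = UNIV, parcs = {(i, j). \<bar>i - j\<bar> \<le> 1}\<rparr>"

definition I_inf2 :: "(int \<times> int) pair_pre_digraph" where
  "I_inf2 =
    \<lparr>pverts = UNIV,
     parcs = {((a, b), (a', b')).
       (a = a' \<and> \<bar>b - b'\<bar> \<le> 1) \<or> (b = b' \<and> \<bar>a - a'\<bar> \<le> 1)}\<rparr>"

lemma reflexive_graph_cycle_graph: "reflexive_graph (cycle_graph k)"
proof
  show "sym (parcs (cycle_graph k))"
  proof (rule symI)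
    fix i j assume "(i, j) \<in> parcs (cycle_graph k)"
    moreover have "[j - i = - d] (mod k)" if "[i - j = d] (mod k)" for d
      using that cong_minus_minus_iff[of "i - j" d k] by simp
    ultimately show "(j, i) \<in> parcs (cycle_graph k)"
      by (fastforce simp: cycle_graph_def)
  qed
qed (auto simp: cycle_graph_def refl_on_def)

lemma reflexive_graph_I_inf: "reflexive_graph I_inf"
  by unfold_locales (auto simp: I_inf_def refl_on_def sym_def)

lemma reflexive_graph_I_inf2: "reflexive_graph I_inf2"
  by unfold_locales (auto simp: I_inf2_def refl_on_def sym_def)

text \<open>
  Stabilization in one coordinate direction is expressed through the family of slices
  \<open>F m\<close> obtained by fixing that coordinate to be \<open>m\<close>. For a map on the line \<open>F\<close> is the map
  itself; for a map on the plane \<open>F m\<close> is a function of the other coordinate, so that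
  \<open>F m = F p\<close> means agreement for all values of that coordinate.
\<close>

definition stable_above :: "(int \<Rightarrow> 'b) \<Rightarrow> int \<Rightarrow> bool" where
  "stable_above F p \<longleftrightarrow> (\<forall>m\<ge>p. F m = F p)"

definition stable_below :: "(int \<Rightarrow> 'b) \<Rightarrow> int \<Rightarrow> bool" where
  "stable_below F q \<longleftrightarrow> (\<forall>m\<le>q. F m = F q)"

definition stabilizes :: "(int \<Rightarrow> 'b) \<Rightarrow> bool" where
  "stabilizes F \<longleftrightarrow> (\<exists>p. stable_above F p) \<and> (\<exists>q. stable_below F q)"

definition pos_index :: "(int \<Rightarrow> 'b) \<Rightarrow> int" where
  "pos_index F = (if \<forall>m m'. F m = F m' then 0 else (LEAST p. stable_above F p))"

definition neg_index :: "(int \<Rightarrow> 'b) \<Rightarrow> int" where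
  "neg_index F = (if \<forall>m m'. F m = F m' then 0 else (GREATEST q. stable_below F q))"

definition slice1 :: "(int \<times> int \<Rightarrow> 'a) \<Rightarrow> int \<Rightarrow> int \<Rightarrow> 'a" where
  "slice1 H m = (\<lambda>j. H (m, j))"

definition slice2 :: "(int \<times> int \<Rightarrow> 'a) \<Rightarrow> int \<Rightarrow> int \<Rightarrow> 'a" where
  "slice2 H m = (\<lambda>i. H (i, m))"

definition S1 :: "'a pair_pre_digraph \<Rightarrow> (int \<Rightarrow> 'a) set" where
  "S1 X = {f \<in> graph_homs I_inf X. stabilizes f}"

definition S2 :: "'a pair_pre_digraph \<Rightarrow> (int \<times> int \<Rightarrow> 'a) set" where
  "S2 X = {H \<in> graph_homs I_inf2 X. stabilizes (slice1 H) \<and> stabilizes (slice2 H)}"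

definition path_homotopy :: "'a pair_pre_digraph \<Rightarrow> ((int \<Rightarrow> 'a) \<times> (int \<Rightarrow> 'a)) set" where
  "path_homotopy X =
    {(f, g). f \<in> S1 X \<and> g \<in> S1 X \<and>
      (\<exists>H \<in> S2 X.
        f (pos_index f) = g (pos_index g) \<and>
        f (neg_index f) = g (neg_index g) \<and>
        (\<forall>j. H (pos_index (slice1 H), j) = f (pos_index f) \<and>
             H (neg_index (slice1 H), j) = f (neg_index f)) \<and>
        (\<forall>j. H (j, neg_index (slice2 H)) = f j \<and>
             H (j, pos_index (slice2 H)) = g j))}"

definition B1 :: "'a pair_pre_digraph \<Rightarrow> 'a \<Rightarrow> (int \<Rightarrow> 'a) set" where
  "B1 X x0 = {f \<in> S1 X. f (neg_index f) = x0 \<and> f (pos_index f) = x0}"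

text \<open>
  Concatenation is meant for \<open>f (neg_index f) = g (pos_index g)\<close>; the two branches then agree
  at \<open>0\<close>. Note that \<open>g\<close> is traversed on the negative side.
\<close>

definition path_concat :: "(int \<Rightarrow> 'a) \<Rightarrow> (int \<Rightarrow> 'a) \<Rightarrow> int \<Rightarrow> 'a" where
  "path_concat f g i = (if i \<ge> 0 then f (i + neg_index f) else g (i + pos_index g))"

text \<open>
  The product of two classes is the union of the classes of \<open>path_concat f g\<close> over all
  representatives, which is a single class since these all coincide.
\<close>

definition A1 :: "'a pair_pre_digraph \<Rightarrow> 'a \<Rightarrow> (int \<Rightarrow> 'a) set monoid" where
  "A1 X x0 =
    \<lparr>carrier = B1 X x0 // path_homotopy X,
     mult = (\<lambda>a b. \<Union>f\<in>a. \<Union>g\<in>b. path_homotopy X `` {path_concat f g}),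
     one = path_homotopy X `` {\<lambda>_. x0}\<rparr>"

end

theory Submission imports Defs begin

text \<open>
  As for the circle, the projection \<open>i \<mapsto> i mod k\<close> from the line to the cycle is treated as a
  covering. A path in \<open>C\<^sub>k\<close> lifts to a map \<open>F\<close> from \<open>\<int>\<close> to \<open>\<int>\<close> with steps in \<open>{-1, 0, 1}\<close>; the
  lift is unique up to a constant, so the difference of its limits at \<open>+\<infinity>\<close> and \<open>-\<infinity>\<close> depends only
  on the path. This displacement is \<open>k\<close> times the winding number when the path is a loop.

  Displacement is a homotopy invariant (\<open>displacement_homotopy_invariant\<close>) because homotopies lift
  one row at a time: given a lift of a row, moving each value by the unique step in \<open>{-1, 0, 1}\<close>
  that leads to the next row gives a map \<open>G\<close> whose increments lie in \<open>[-3, 3]\<close> and are congruent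
  modulo \<open>k\<close> to a step in \<open>[-1, 1]\<close>. The two differ by at most \<open>4 < k\<close>, so they are equal and \<open>G\<close>
  is again a lift. This is where \<open>k \<ge> 5\<close> enters: for \<open>k = 3\<close> and \<open>k = 4\<close> the cycle itself bounds
  a triangle or a square, and it is null-homotopic.

  Conversely, two paths with a common start and equal displacement have lifts \<open>F\<close> and \<open>G\<close> that
  agree near both ends. Clamping \<open>G\<close> to the growing band \<open>[F - j, F + j]\<close> deforms \<open>F\<close> into \<open>G\<close>,
  and reducing modulo \<open>k\<close> gives a homotopy (\<open>path_homotopic_if_displacement_eq\<close>).

  Hence the homotopy classes of loops are exactly the sets of loops of a given winding number.
  Every integer occurs, and displacements add under concatenation, so sending \<open>n\<close> to the class of
  winding number \<open>n\<close> is an isomorphism from \<open>\<int>\<close>; the group laws of \<open>A\<^sub>1\<close> are transported along it.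
\<close>

section \<open>Limits of stable maps\<close>

lemma stable_aboveD: "stable_above F p \<Longrightarrow> p \<le> m \<Longrightarrow> F m = F p"
  unfolding stable_above_def by blast

lemma stable_belowD: "stable_below F q \<Longrightarrow> m \<le> q \<Longrightarrow> F m = F q"
  unfolding stable_below_def by blast

lemma stable_above_mono: "stable_above F p \<Longrightarrow> p \<le> p' \<Longrightarrow> stable_above F p'"
  unfolding stable_above_def by (metis order_trans)

lemma stable_below_mono: "stable_below F q \<Longrightarrow> q' \<le> q \<Longrightarrow> stable_below F q'"
  unfolding stable_below_def by (metis order_trans)

lemma stable_above_step: "stable_above F p \<Longrightarrow> p \<le> m \<Longrightarrow> F (m + 1) = F m"
  unfolding stable_above_def by (metis order_trans zle_add1_eq_le less_imp_le)

lemma stable_below_step: "stable_below F q \<Longrightarrow> m < q \<Longrightarrow> F (m + 1) = F m"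
  unfolding stable_below_def by (metis add1_zle_eq less_imp_le)

lemma stable_above_unique: "stable_above F p \<Longrightarrow> stable_above F p' \<Longrightarrow> F p = F p'"
  unfolding stable_above_def by (metis linear)

lemma stable_below_unique: "stable_below F q \<Longrightarrow> stable_below F q' \<Longrightarrow> F q = F q'"
  unfolding stable_below_def by (metis linear)

lemma int_least_exists:
  fixes P :: "int \<Rightarrow> bool"
  assumes "P p" and lower: "\<And>p. P p \<Longrightarrow> l \<le> p"
  obtains m where "P m" "\<And>p. P p \<Longrightarrow> m \<le> p"
proof -
  define n where "n = (LEAST n. P (l + int n))"
  have "P (l + int (nat (p - l)))"
    using assms by simp
  then have n: "P (l + int n)"
    unfolding n_def by (rule LeastI)
  have "l + int n \<le> p'" if "P p'" for p'
  proof -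
    have "n \<le> nat (p' - l)"
      unfolding n_def by (rule Least_le) (use that lower[OF that] in simp)
    then show ?thesis using lower[OF that] by linarith
  qed
  with n that show thesis by blast
qed

text \<open>
  If \<open>F\<close> is not constant then it cannot be stable above every integer, so the least index of
  stability really exists and \<open>LEAST\<close> denotes it; constant \<open>F\<close> has the default value \<open>0\<close>.
\<close>

lemma stable_above_pos_index:
  assumes "stable_above F p"
  shows "stable_above F (pos_index F)"
proof (cases "\<forall>m m'. F m = F m'")
  case True
  then show ?thesis by (auto simp: stable_above_def)
next
  case False
  then obtain m m' where "F m \<noteq> F m'" by blast
  then have "\<not> stable_above F (min m m')"
    unfolding stable_above_def by (metis min.cobounded1 min.cobounded2)
  then have lower: "min m m' \<le> p'" if "stable_above F p'" for p'
    using stable_above_mono[OF that, of "min m m'"] by linarith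
  obtain p0 where p0: "stable_above F p0" "\<And>p. stable_above F p \<Longrightarrow> p0 \<le> p"
    using int_least_exists[of "stable_above F", OF assms lower] by blast
  then have "(LEAST p. stable_above F p) = p0"
    by (intro Least_equality)
  with p0(1) False show ?thesis unfolding pos_index_def by (simp only: if_False)
qed

lemma stable_below_neg_index:
  assumes "stable_below F q"
  shows "stable_below F (neg_index F)"
proof (cases "\<forall>m m'. F m = F m'")
  case True
  then show ?thesis by (auto simp: stable_below_def)
next
  case False
  then obtain m m' where "F m \<noteq> F m'" by blast
  then have "\<not> stable_below F (max m m')"
    unfolding stable_below_def by (metis max.cobounded1 max.cobounded2)
  then have upper: "- max m m' \<le> p" if "stable_below F (- p)" for p
    using stable_below_mono[OF that, of "max m m'"] by linarith
  obtain p0 where p0: "stable_below F (- p0)" "\<And>p. stable_below F (- p) \<Longrightarrow> p0 \<le> p"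
    using int_least_exists[of "\<lambda>p. stable_below F (- p)", of "- q", OF _ upper] assms by auto
  have "(GREATEST q. stable_below F q) = - p0"
    by (rule Greatest_equality) (use p0(1) p0(2)[of "- q'" for q'] in force)+
  with p0(1) False show ?thesis unfolding neg_index_def by (simp only: if_False)
qed

text \<open>
  The stabilization indices in the definition of a homotopy only serve to name limit values, and a
  limit can be read off at any sufficiently large argument. Arbitrary bounds \<open>a\<close>, \<open>b\<close>, \<open>p\<close>, \<open>q\<close> can
  therefore replace the optimal ones. The agreement of the end points of \<open>f\<close> and \<open>g\<close> comes from the
  corners of the grid, where the constant columns meet the rows \<open>f\<close> and \<open>g\<close>.
\<close>

lemma path_homotopy_iff:
  "(f, g) \<in> path_homotopy X \<longleftrightarrow> f \<in> S1 X \<and> g \<in> S1 X \<and>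
    (\<exists>H \<in> graph_homs I_inf2 X. \<exists>a b p q.
      (\<forall>i. \<forall>j\<le>a. H (i, j) = f i) \<and> (\<forall>i. \<forall>j\<ge>b. H (i, j) = g i) \<and>
      (\<forall>j. \<forall>i\<ge>p. H (i, j) = f p) \<and> (\<forall>j. \<forall>i\<le>q. H (i, j) = f q))"
  (is "?L \<longleftrightarrow> ?R")
proof
  assume ?L
  then obtain H where fg: "f \<in> S1 X" "g \<in> S1 X" and H: "H \<in> S2 X"
    and ends: "\<And>j. H (pos_index (slice1 H), j) = f (pos_index f)"
              "\<And>j. H (neg_index (slice1 H), j) = f (neg_index f)"
    and rows: "\<And>i. H (i, neg_index (slice2 H)) = f i"
              "\<And>i. H (i, pos_index (slice2 H)) = g i"
    unfolding path_homotopy_def by blast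
  have "stable_above (slice1 H) (pos_index (slice1 H))" "stable_above (slice2 H) (pos_index (slice2 H))"
    "stable_below (slice1 H) (neg_index (slice1 H))" "stable_below (slice2 H) (neg_index (slice2 H))"
    using H stable_above_pos_index stable_below_neg_index
    unfolding S2_def stabilizes_def by blast+
  then have "\<forall>i. \<forall>j\<le>neg_index (slice2 H). H (i, j) = f i"
      "\<forall>i. \<forall>j\<ge>pos_index (slice2 H). H (i, j) = g i"
      "\<forall>j. \<forall>i\<ge>pos_index (slice1 H). H (i, j) = f (pos_index (slice1 H))"
      "\<forall>j. \<forall>i\<le>neg_index (slice1 H). H (i, j) = f (neg_index (slice1 H))"
    using ends rows unfolding stable_above_def stable_below_def slice1_def slice2_def
    by metis+
  with fg H show ?R unfolding S2_def by blast
next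
  assume ?R
  then obtain H a b p q where fg: "f \<in> S1 X" "g \<in> S1 X" and H: "H \<in> graph_homs I_inf2 X"
    and rows: "\<And>i j. j \<le> a \<Longrightarrow> H (i, j) = f i" "\<And>i j. j \<ge> b \<Longrightarrow> H (i, j) = g i"
    and ends: "\<And>i j. i \<ge> p \<Longrightarrow> H (i, j) = f p" "\<And>i j. i \<le> q \<Longrightarrow> H (i, j) = f q"
    by blast
  have st: "stable_above (slice1 H) p" "stable_below (slice1 H) q"
    "stable_above (slice2 H) b" "stable_below (slice2 H) a"
    using rows ends unfolding stable_above_def stable_below_def slice1_def slice2_def by auto
  have fst: "stable_above f p" "stable_below f q"
    using rows(1)[of a] ends unfolding stable_above_def stable_below_def by (metis order_refl)+
  have gst: "stable_above g p" "stable_below g q"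
    using rows(2)[of b] ends unfolding stable_above_def stable_below_def by (metis order_refl)+
  have gf: "g p = f p" "g q = f q"
    using rows(2)[of b] ends by (metis order_refl)+
  have lim: "f (pos_index f) = f p" "f (neg_index f) = f q"
      "g (pos_index g) = f p" "g (neg_index g) = f q"
      "slice1 H (pos_index (slice1 H)) = slice1 H p"
      "slice1 H (neg_index (slice1 H)) = slice1 H q"
      "slice2 H (pos_index (slice2 H)) = slice2 H b"
      "slice2 H (neg_index (slice2 H)) = slice2 H a"
    using st fst gst gf stable_above_pos_index stable_below_neg_index
      stable_above_unique stable_below_unique by metis+
  have "H \<in> S2 X" using H st by (auto simp: S2_def stabilizes_def)
  moreover have "H (pos_index (slice1 H), j) = f (pos_index f)"
      "H (neg_index (slice1 H), j) = f (neg_index f)"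
      "H (i, neg_index (slice2 H)) = f i" "H (i, pos_index (slice2 H)) = g i" for i j
    using lim rows ends by (auto simp: slice1_def slice2_def dest!: fun_cong)
  moreover have "f (pos_index f) = g (pos_index g)" "f (neg_index f) = g (neg_index g)"
    using lim(1-4) by simp_all
  ultimately show ?L using fg unfolding path_homotopy_def by blast
qed

section \<open>Lifts to the line\<close>

definition is_lift :: "int \<Rightarrow> (int \<Rightarrow> int) \<Rightarrow> (int \<Rightarrow> int) \<Rightarrow> bool" where
  "is_lift k F f \<longleftrightarrow> (\<forall>i. \<bar>F (i + 1) - F i\<bar> \<le> 1) \<and> (\<forall>i. F i mod k = f i)"

text \<open>
  The representative of \<open>y - x\<close> modulo \<open>k\<close> in \<open>{-1, \<dots>, k - 2}\<close>. For adjacent vertices it is the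
  step in \<open>{-1, 0, 1}\<close> that leads from \<open>x\<close> to \<open>y\<close>.
\<close>

definition cycle_step :: "int \<Rightarrow> int \<Rightarrow> int \<Rightarrow> int" where
  "cycle_step k x y = (y - x + 1) mod k - 1"

lemma mod_add_cycle_step: "(z + cycle_step k (z mod k) y) mod k = y mod k"
proof -
  have "(z + cycle_step k (z mod k) y) mod k = (z + ((y - z mod k + 1) - 1)) mod k"
    unfolding cycle_step_def by (metis mod_add_right_eq mod_diff_left_eq)
  also have "\<dots> = (z - z mod k + y) mod k" by (simp add: algebra_simps)
  also have "\<dots> = y mod k" by (metis minus_mod_eq_mult_div mod_mult_self4)
  finally show ?thesis .
qed

lemma cycle_step_self: "k \<ge> 2 \<Longrightarrow> cycle_step k x x = 0"
  by (simp add: cycle_step_def)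

lemma cycle_parcs_sym: "(x, y) \<in> parcs (cycle_graph k) \<Longrightarrow> (y, x) \<in> parcs (cycle_graph k)"
  using reflexive_graph.undirected[OF reflexive_graph_cycle_graph] by (rule symD)

lemma abs_cycle_step_le:
  assumes "k > 0" and "(x, y) \<in> parcs (cycle_graph k)"
  shows "\<bar>cycle_step k x y\<bar> \<le> 1"
proof -
  from cycle_parcs_sym[OF assms(2)]
  obtain d where "[y - x = d] (mod k)" "d = 0 \<or> d = 1 \<or> d = -1"
    unfolding cycle_graph_def by auto
  then have "(y - x + 1) mod k = (d + 1) mod k"
    unfolding cong_def by (metis mod_add_left_eq)
  moreover have "(d + 1) mod k \<le> d + 1" "0 \<le> (d + 1) mod k"
    using \<open>k > 0\<close> \<open>d = 0 \<or> d = 1 \<or> d = -1\<close> by (auto intro: zmod_le_nonneg_dividend)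
  ultimately show ?thesis
    using \<open>d = 0 \<or> d = 1 \<or> d = -1\<close> unfolding cycle_step_def by auto
qed

lemma cycle_parcs_mod:
  assumes "k > 0" and "\<bar>a - b\<bar> \<le> 1"
  shows "(a mod k, b mod k) \<in> parcs (cycle_graph k)"
proof -
  have "[a mod k - b mod k = a - b] (mod k)"
    by (simp add: cong_def mod_diff_eq)
  moreover have "a - b = 0 \<or> a - b = 1 \<or> a - b = -1" using assms by linarith
  ultimately show ?thesis using \<open>k > 0\<close> unfolding cycle_graph_def by auto
qed

lemma path_in_cycle_mod: "f \<in> graph_homs I_inf (cycle_graph k) \<Longrightarrow> f i mod k = f i"
  by (auto simp: graph_homs_def I_inf_def cycle_graph_def Pi_iff)

lemma antidifference_exists:
  fixes t :: "int \<Rightarrow> int"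
  obtains F where "F 0 = c" "\<And>i. F (i + 1) = F i + t i"
proof -
  define F where "F i = c + (if i \<ge> 0 then sum t {0..<i} else - sum t {i..<0})" for i
  have "F (i + 1) = F i + t i" for i
  proof -
    consider "i \<ge> 0" | "i = -1" | "i < -1" by linarith
    then show ?thesis
    proof cases
      case 1
      then have "{0..<i + 1} = insert i {0..<i}" by auto
      with 1 show ?thesis by (simp add: F_def)
    next
      case 2
      then have "{i..<0} = {i}" by auto
      with 2 show ?thesis by (simp add: F_def)
    next
      case 3
      then have "{i..<0} = insert i {i + 1..<0}" by auto
      with 3 show ?thesis by (simp add: F_def)
    qed
  qed
  moreover have "F 0 = c" by (simp add: F_def)
  ultimately show thesis using that by blast
qed

text \<open>
  The lift starts at \<open>f 0\<close> and accumulates the steps of \<open>f\<close> in both directions.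
\<close>

lemma lift_exists:
  assumes "k > 0" and f: "f \<in> graph_homs I_inf (cycle_graph k)"
  obtains F where "is_lift k F f"
proof -
  obtain F where F0: "F 0 = f 0" and F: "\<And>i. F (i + 1) = F i + cycle_step k (f i) (f (i + 1))"
    using antidifference_exists[of "f 0" "\<lambda>i. cycle_step k (f i) (f (i + 1))"] by auto
  have edge: "(f i, f (i + 1)) \<in> parcs (cycle_graph k)" for i
    using f by (auto simp: graph_homs_def I_inf_def)
  note range = path_in_cycle_mod[OF f]
  have "F i mod k = f i" for i
  proof (induction i rule: int_induct[where k = 0])
    case base
    show ?case using F0 range by simp
  next
    case (step1 i)
    then show ?case using F[of i] mod_add_cycle_step[of "F i" k "f (i + 1)"] range by simp
  next
    case (step2 i)
    let ?s = "cycle_step k (f (i - 1)) (f i)"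
    have "F (i - 1) = F i - ?s" using F[of "i - 1"] by simp
    then have "F (i - 1) mod k = (f i - ?s) mod k"
      using step2 by (metis mod_diff_left_eq)
    also have "f i - ?s = f i + 1 - (f i - f (i - 1) + 1) mod k"
      by (simp add: cycle_step_def)
    also have "\<dots> mod k = (f i + 1 - (f i - f (i - 1) + 1)) mod k"
      by (rule mod_diff_right_eq)
    finally show ?case using range by simp
  qed
  moreover have "\<bar>F (i + 1) - F i\<bar> \<le> 1" for i
    using F abs_cycle_step_le[OF \<open>k > 0\<close> edge] by simp
  ultimately show thesis using that by (auto simp: is_lift_def)
qed

lemma lift_imp_hom:
  assumes "k > 0" and F: "is_lift k F f"
  shows "f \<in> graph_homs I_inf (cycle_graph k)"
proof -
  have f: "f i = F i mod k" for i using F by (simp add: is_lift_def)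
  have "(f i, f j) \<in> parcs (cycle_graph k)" if "\<bar>i - j\<bar> \<le> 1" for i j
  proof -
    from that have "i = j \<or> j = i + 1 \<or> i = j + 1" by arith
    then have "\<bar>F i - F j\<bar> \<le> 1"
      using F unfolding is_lift_def by (auto simp: abs_minus_commute)
    with \<open>k > 0\<close> show ?thesis by (simp add: f cycle_parcs_mod)
  qed
  moreover have "f i \<in> pverts (cycle_graph k)" for i
    using \<open>k > 0\<close> by (simp add: f cycle_graph_def)
  ultimately show ?thesis by (auto simp: graph_homs_def I_inf_def)
qed

lemma dvd_abs_less_imp_eq_0: "k dvd d \<Longrightarrow> \<bar>d\<bar> < k \<Longrightarrow> d = 0" for d k :: int
  by (metis abs_of_pos dvd_imp_le_int leD order_le_less_trans abs_ge_zero)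

lemma stable_aboveI:
  assumes "\<And>m. m \<ge> p \<Longrightarrow> F (m + 1) = F m"
  shows "stable_above F p"
  unfolding stable_above_def
proof (intro allI impI)
  fix m assume "p \<le> m"
  then show "F m = F p" by (induction rule: int_ge_induct) (use assms in auto)
qed

lemma stable_belowI:
  assumes "\<And>m. m < q \<Longrightarrow> F (m + 1) = F m"
  shows "stable_below F q"
  unfolding stable_below_def
proof (intro allI impI)
  fix m assume "m \<le> q"
  then show "F m = F q"
  proof (induction rule: int_le_induct)
    case (step i)
    then show ?case using assms[of "i - 1"] by simp
  qed simp
qed

text \<open>
  A step of a lift that projects to no movement is a multiple of \<open>k\<close> of absolute value at most \<open>1\<close>.
  Hence a lift is stable wherever its path is.
\<close>

lemma lift_step_eqI:
  assumes "k \<ge> 2" and F: "is_lift k F f" and "f (m + 1) = f m"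
  shows "F (m + 1) = F m"
proof -
  have "k dvd F (m + 1) - F m"
    using F assms(3) by (simp add: is_lift_def mod_eq_dvd_iff[symmetric])
  moreover have "\<bar>F (m + 1) - F m\<bar> < k"
    using F \<open>k \<ge> 2\<close> unfolding is_lift_def by (smt (verit))
  ultimately show ?thesis using dvd_abs_less_imp_eq_0 by fastforce
qed

lemma lift_stable_above:
  assumes "k \<ge> 2" "is_lift k F f" "stable_above f p"
  shows "stable_above F p"
  by (intro stable_aboveI lift_step_eqI[OF assms(1,2)] stable_above_step[OF assms(3)])

lemma lift_stable_below:
  assumes "k \<ge> 2" "is_lift k F f" "stable_below f q"
  shows "stable_below F q"
  by (intro stable_belowI lift_step_eqI[OF assms(1,2)] stable_below_step[OF assms(3)])

text \<open>
  The difference of two lifts is a multiple of \<open>k\<close> that changes by at most \<open>2 < k\<close> per step, so it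
  is constant.
\<close>

lemma lift_unique:
  assumes "k \<ge> 3" and F: "is_lift k F f" and G: "is_lift k G f"
  shows "F i - F j = G i - G j"
proof -
  let ?D = "\<lambda>i. F i - G i"
  have "?D (m + 1) = ?D m" for m
  proof -
    have dvd: "k dvd ?D l" for l
    proof -
      have "F l mod k = G l mod k" using F G by (simp add: is_lift_def)
      then show ?thesis by (simp only: mod_eq_dvd_iff)
    qed
    have "k dvd ?D (m + 1) - ?D m" by (rule dvd_diff[OF dvd dvd])
    moreover have "\<bar>?D (m + 1) - ?D m\<bar> < k"
      using F G \<open>k \<ge> 3\<close> unfolding is_lift_def by (smt (verit))
    ultimately show ?thesis using dvd_abs_less_imp_eq_0 by fastforce
  qed
  then have "stable_above ?D (min i j)" by (intro stable_aboveI)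
  then have "?D i = ?D j" unfolding stable_above_def by (metis min.cobounded1 min.cobounded2)
  then show ?thesis by linarith
qed

definition displacement :: "int \<Rightarrow> (int \<Rightarrow> int) \<Rightarrow> int" where
  "displacement k f = (let F = SOME F. is_lift k F f in F (pos_index f) - F (neg_index f))"

text \<open>
  The choice of the lift in the definition is harmless by uniqueness, and the stabilization indices
  may be replaced by any bounds beyond which the path is constant.
\<close>

lemma displacement_eq:
  assumes "k \<ge> 3" and F: "is_lift k F f" and st: "stable_above f p" "stable_below f q"
  shows "displacement k f = F p - F q"
proof -
  have "is_lift k (SOME F. is_lift k F f) f" by (rule someI[of "\<lambda>F. is_lift k F f", OF F])
  then have "displacement k f = F (pos_index f) - F (neg_index f)"
    unfolding displacement_def Let_def using assms(1) F lift_unique by blast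
  moreover have "F (pos_index f) = F p" "F (neg_index f) = F q"
    using assms lift_stable_above[OF _ F] lift_stable_below[OF _ F]
      stable_above_pos_index[OF st(1)] stable_below_neg_index[OF st(2)]
      stable_above_unique stable_below_unique by (smt (verit))+
  ultimately show ?thesis by simp
qed

text \<open>
  Homotopies lift row by row. The increments of the new map are bounded by \<open>3\<close> and congruent to a
  step of \<open>g\<close>; as \<open>3 + 1 < k\<close>, they are equal to that step.
\<close>

lemma lift_of_adjacent_path:
  assumes "k \<ge> 5" and F: "is_lift k F f" and g: "g \<in> graph_homs I_inf (cycle_graph k)"
    and adj: "\<And>i. (f i, g i) \<in> parcs (cycle_graph k)"
  shows "is_lift k (\<lambda>i. F i + cycle_step k (f i) (g i)) g"
proof -
  let ?G = "\<lambda>i. F i + cycle_step k (f i) (g i)"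
  note g_mod = path_in_cycle_mod[OF g]
  have G_mod: "?G i mod k = g i" for i
    using F mod_add_cycle_step[of "F i" k "g i"] g_mod by (simp add: is_lift_def)
  have "\<bar>?G (i + 1) - ?G i\<bar> \<le> 1" for i
  proof -
    define s where "s = cycle_step k (g i) (g (i + 1))"
    have "(g i, g (i + 1)) \<in> parcs (cycle_graph k)"
      using g by (auto simp: graph_homs_def I_inf_def)
    then have s: "\<bar>s\<bar> \<le> 1" unfolding s_def using abs_cycle_step_le assms(1) by auto
    have "(?G i + s) mod k = ?G (i + 1) mod k"
      using mod_add_cycle_step[of "?G i" k "g (i + 1)"] G_mod g_mod by (simp add: s_def)
    then have "k dvd ?G (i + 1) - ?G i - s"
      by (metis mod_eq_dvd_iff diff_diff_eq)
    moreover have "\<bar>?G (i + 1) - ?G i - s\<bar> < k"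
    proof -
      have "\<bar>cycle_step k (f i) (g i)\<bar> \<le> 1" "\<bar>cycle_step k (f (i + 1)) (g (i + 1))\<bar> \<le> 1"
        using abs_cycle_step_le adj assms(1) by auto
      moreover have "\<bar>F (i + 1) - F i\<bar> \<le> 1" using F by (simp add: is_lift_def)
      ultimately show ?thesis using s \<open>k \<ge> 5\<close> by linarith
    qed
    ultimately have "?G (i + 1) - ?G i - s = 0" by (rule dvd_abs_less_imp_eq_0)
    with s show ?thesis by linarith
  qed
  with G_mod show ?thesis by (simp add: is_lift_def)
qed

text \<open>
  Where both rows sit at the same end point, the step between them is \<open>0\<close>. The lifts of
  consecutive rows therefore coincide near the ends and have the same displacement.
\<close>

lemma displacement_homotopy_invariant:
  assumes "k \<ge> 5" and "(f, g) \<in> path_homotopy (cycle_graph k)"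
  shows "displacement k f = displacement k g"
proof -
  obtain H a b p q where f: "f \<in> S1 (cycle_graph k)" and g: "g \<in> S1 (cycle_graph k)"
    and H: "H \<in> graph_homs I_inf2 (cycle_graph k)"
    and rows: "\<And>i j. j \<le> a \<Longrightarrow> H (i, j) = f i" "\<And>i j. j \<ge> b \<Longrightarrow> H (i, j) = g i"
    and ends: "\<And>i j. i \<ge> p \<Longrightarrow> H (i, j) = f p" "\<And>i j. i \<le> q \<Longrightarrow> H (i, j) = f q"
    using assms(2) unfolding path_homotopy_iff by blast
  have stable: "stable_above (\<lambda>i. H (i, j)) p" "stable_below (\<lambda>i. H (i, j)) q" for j
    using ends by (auto simp: stable_above_def stable_below_def)
  have row_hom: "(\<lambda>i. H (i, j)) \<in> graph_homs I_inf (cycle_graph k)" for j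
    using H by (auto simp: graph_homs_def I_inf_def I_inf2_def)
  have step: "displacement k (\<lambda>i. H (i, j + 1)) = displacement k (\<lambda>i. H (i, j))" for j
  proof -
    obtain F where F: "is_lift k F (\<lambda>i. H (i, j))"
      using lift_exists[OF _ row_hom] assms(1) by (metis less_le_trans zero_less_numeral)
    let ?G = "\<lambda>i. F i + cycle_step k (H (i, j)) (H (i, j + 1))"
    have "(H (i, j), H (i, j + 1)) \<in> parcs (cycle_graph k)" for i
      using H by (auto simp: graph_homs_def I_inf2_def)
    then have "is_lift k ?G (\<lambda>i. H (i, j + 1))"
      using lift_of_adjacent_path[OF assms(1) F row_hom] by simp
    then have "displacement k (\<lambda>i. H (i, j + 1)) = ?G p - ?G q"
      by (intro displacement_eq stable) (use assms(1) in simp)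
    also have "\<dots> = F p - F q" using ends assms(1) by (simp add: cycle_step_self)
    also have "\<dots> = displacement k (\<lambda>i. H (i, j))"
      using displacement_eq[OF _ F stable] assms(1) by simp
    finally show ?thesis .
  qed
  let ?D = "\<lambda>j. displacement k (\<lambda>i. H (i, j))"
  have "stable_above ?D (min a b)" using step by (intro stable_aboveI)
  then have "?D a = ?D b" unfolding stable_above_def by (metis min.cobounded1 min.cobounded2)
  moreover have "(\<lambda>i. H (i, a)) = f" "(\<lambda>i. H (i, b)) = g" using rows by auto
  ultimately show ?thesis by simp
qed

lemma mod_grid_hom:
  fixes K :: "int \<times> int \<Rightarrow> int"
  assumes "k > 0" and "\<And>i j. \<bar>K (i + 1, j) - K (i, j)\<bar> \<le> 1" "\<And>i j. \<bar>K (i, j + 1) - K (i, j)\<bar> \<le> 1"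
  shows "(\<lambda>x. K x mod k) \<in> graph_homs I_inf2 (cycle_graph k)"
proof -
  have "\<bar>K (i, j) - K (i', j')\<bar> \<le> 1" if "(i = i' \<and> \<bar>j - j'\<bar> \<le> 1) \<or> (j = j' \<and> \<bar>i - i'\<bar> \<le> 1)" for i j i' j'
  proof -
    from that have "(i = i' \<and> (j = j' \<or> j = j' + 1 \<or> j' = j + 1)) \<or>
        (j = j' \<and> (i = i' + 1 \<or> i' = i + 1))" by arith
    then show ?thesis using assms(2,3) by (auto simp: abs_minus_commute)
  qed
  then show ?thesis using \<open>k > 0\<close>
    by (auto simp: graph_homs_def I_inf2_def cycle_parcs_mod) (auto simp: cycle_graph_def)
qed

text \<open>
  Lifts of the two paths that start at the same integer also end at the same integer, and \<open>\<int>\<close> has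
  no obstruction to deforming one into the other. Agreement of the end points on the right thus
  follows from the equality of displacements.
\<close>

lemma path_homotopic_if_displacement_eq:
  assumes "k \<ge> 3" and f: "f \<in> S1 (cycle_graph k)" and g: "g \<in> S1 (cycle_graph k)"
    and start: "f (neg_index f) = g (neg_index g)" and disp: "displacement k f = displacement k g"
  shows "(f, g) \<in> path_homotopy (cycle_graph k)"
proof -
  obtain F where F: "is_lift k F f"
    using lift_exists f assms(1) unfolding S1_def by (smt (verit) mem_Collect_eq)
  obtain G' where G': "is_lift k G' g"
    using lift_exists g assms(1) unfolding S1_def by (smt (verit) mem_Collect_eq)
  \<comment> \<open>the lift of \<open>g\<close>, shifted by a multiple of \<open>k\<close> to start where \<open>F\<close> starts\<close>
  define G where "G i = G' i - G' (neg_index g) + F (neg_index f)" for i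
  have "[F (neg_index f) = G' (neg_index g)] (mod k)"
    using start F G' by (simp add: is_lift_def cong_def)
  then have "[G i = G' i] (mod k)" for i
    unfolding G_def using cong_add[OF cong_refl[of "G' i - G' (neg_index g)"]] by fastforce
  then have G: "is_lift k G g"
    using G' by (simp add: is_lift_def G_def cong_def)
  have ends: "stable_above f (pos_index f)" "stable_below f (neg_index f)"
    "stable_above g (pos_index g)" "stable_below g (neg_index g)"
    using f g stable_above_pos_index stable_below_neg_index
    unfolding S1_def stabilizes_def by blast+
  define p where "p = max (pos_index f) (pos_index g)"
  define q where "q = min (neg_index f) (neg_index g)"
  have st: "stable_above f p" "stable_above g p" "stable_below f q" "stable_below g q"
    using ends stable_above_mono stable_below_mono unfolding p_def q_def
    by (metis max.cobounded1 max.cobounded2 min.cobounded1 min.cobounded2)+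
  have stF: "stable_above F p" "stable_below F q" "stable_above G p" "stable_below G q"
      "stable_below F (neg_index f)" "stable_below G (neg_index g)"
    using st ends lift_stable_above lift_stable_below F G assms(1) by (smt (verit))+
  have "F q = G q"
    using stF stable_below_unique[of F q "neg_index f"] stable_below_unique[of G q "neg_index g"]
    by (simp add: G_def)
  moreover have "F p - F q = G p - G q"
    using disp displacement_eq[OF assms(1) F st(1,3)] displacement_eq[OF assms(1) G st(2,4)] by simp
  ultimately have FG: "F i = G i" if "i \<ge> p \<or> i \<le> q" for i
    using stF that unfolding stable_above_def stable_below_def by (smt (verit))
  \<comment> \<open>a time after which the band contains all of \<open>G\<close>\<close>
  define b where "b = Max ((\<lambda>i. \<bar>F i - G i\<bar>) ` {q..p} \<union> {0})"
  have b: "\<bar>F i - G i\<bar> \<le> b" for i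
  proof (cases "i \<in> {q..p}")
    case True
    then show ?thesis unfolding b_def by (intro Max_ge) auto
  next
    case False
    then have "F i = G i" using FG by auto
    then show ?thesis unfolding b_def by (simp add: Max_ge)
  qed
  \<comment> \<open>the median of \<open>F - j\<close>, \<open>G\<close> and \<open>F + j\<close>: it is \<open>F\<close> for \<open>j \<le> 0\<close>, and it moves by at most
     one in either direction because \<open>max\<close> and \<open>min\<close> do not increase distances\<close>
  define K where "K = (\<lambda>(i, j). max (F i - max 0 j) (min (G i) (F i + max 0 j)))"
  have F1: "\<bar>F (i + 1) - F i\<bar> \<le> 1" and G1: "\<bar>G (i + 1) - G i\<bar> \<le> 1" for i
    using F G by (auto simp: is_lift_def)
  have "\<bar>K (i + 1, j) - K (i, j)\<bar> \<le> 1" for i j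
    using F1[of i] G1[of i] unfolding K_def prod.case by linarith
  moreover have "\<bar>K (i, j + 1) - K (i, j)\<bar> \<le> 1" for i j
    unfolding K_def prod.case by linarith
  moreover define H where "H x = K x mod k" for x
  ultimately have hom: "H \<in> graph_homs I_inf2 (cycle_graph k)"
    unfolding H_def using mod_grid_hom assms(1) by simp
  have KF: "K (i, j) = F i" if "j \<le> 0 \<or> i \<ge> p \<or> i \<le> q" for i j
    using that FG[of i] unfolding K_def by auto
  have KG: "K (i, j) = G i" if "j \<ge> b" for i j
    using that b[of i] unfolding K_def prod.case by linarith
  have fF: "F i mod k = f i" and gG: "G i mod k = g i" for i
    using F G by (auto simp: is_lift_def)
  have "\<forall>i. \<forall>j\<le>0. H (i, j) = f i" "\<forall>i. \<forall>j\<ge>b. H (i, j) = g i"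
    unfolding H_def by (simp_all add: KF KG fF gG)
  moreover have "\<forall>j. \<forall>i\<ge>p. H (i, j) = f p" "\<forall>j. \<forall>i\<le>q. H (i, j) = f q"
    unfolding H_def using KF fF stable_aboveD[OF st(1)] stable_belowD[OF st(3)] by metis+
  ultimately show ?thesis unfolding path_homotopy_iff using f g hom by blast
qed

section \<open>The fundamental group\<close>

lemma path_homotopy_ends:
  "(f, g) \<in> path_homotopy X \<Longrightarrow> f \<in> B1 X x \<Longrightarrow> g \<in> B1 X x"
  unfolding path_homotopy_def B1_def by auto

lemma B1_iff:
  assumes "stable_above f p" "stable_below f q"
  shows "f \<in> B1 X x \<longleftrightarrow> f \<in> graph_homs I_inf X \<and> f p = x \<and> f q = x"
proof -
  have "f (pos_index f) = f p" "f (neg_index f) = f q"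
    using assms stable_above_pos_index stable_below_neg_index
      stable_above_unique stable_below_unique by metis+
  moreover have "stabilizes f" using assms by (auto simp: stabilizes_def)
  ultimately show ?thesis by (auto simp: B1_def S1_def)
qed

definition loops_winding :: "int \<Rightarrow> int \<Rightarrow> (int \<Rightarrow> int) set" where
  "loops_winding k n = {f \<in> B1 (cycle_graph k) 0. displacement k f = k * n}"

text \<open>
  The two halves of the covering argument together: homotopy of loops is equality of displacement.
\<close>

lemma path_homotopy_class:
  assumes "k \<ge> 5" "f \<in> loops_winding k n"
  shows "path_homotopy (cycle_graph k) `` {f} = loops_winding k n"
proof (intro equalityI subsetI)
  fix g assume "g \<in> path_homotopy (cycle_graph k) `` {f}"
  then show "g \<in> loops_winding k n"
    using assms path_homotopy_ends[of f g] displacement_homotopy_invariant[OF assms(1), of f g]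
    by (auto simp: loops_winding_def)
next
  fix g assume "g \<in> loops_winding k n"
  with assms have "(f, g) \<in> path_homotopy (cycle_graph k)"
    by (intro path_homotopic_if_displacement_eq) (auto simp: loops_winding_def B1_def)
  then show "g \<in> path_homotopy (cycle_graph k) `` {f}" by simp
qed

lemma B1_lift:
  assumes "k \<ge> 3" "f \<in> B1 (cycle_graph k) x"
  obtains F where "is_lift k F f" "stable_above f (pos_index f)" "stable_below f (neg_index f)"
    "f (pos_index f) = x" "f (neg_index f) = x" "displacement k f = F (pos_index f) - F (neg_index f)"
proof -
  have "f \<in> graph_homs I_inf (cycle_graph k)" using assms(2) by (simp add: B1_def S1_def)
  then obtain F where F: "is_lift k F f"
    using lift_exists[of k f] assms(1) by auto
  have st: "stable_above f (pos_index f)" "stable_below f (neg_index f)"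
    using assms(2) stable_above_pos_index stable_below_neg_index
    unfolding B1_def S1_def stabilizes_def by blast+
  show thesis
    using that[OF F st] assms(2) displacement_eq[OF assms(1) F st] by (simp add: B1_def)
qed

text \<open>
  Both ends of a lift of a loop at \<open>0\<close> project to \<open>0\<close>, so the displacement is a multiple of \<open>k\<close>.
\<close>

lemma B1_in_loops_winding:
  assumes "k \<ge> 3" "f \<in> B1 (cycle_graph k) 0"
  obtains n where "f \<in> loops_winding k n"
proof -
  from B1_lift[OF assms] obtain F where F: "is_lift k F f" "f (pos_index f) = 0" "f (neg_index f) = 0"
    "displacement k f = F (pos_index f) - F (neg_index f)" by metis
  then have "k dvd displacement k f"
    by (simp add: is_lift_def mod_eq_dvd_iff[symmetric])
  then show thesis using that assms(2) by (auto simp: loops_winding_def)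
qed

text \<open>
  The loop that walks \<open>k * \<bar>n\<bar>\<close> steps in the direction of the sign of \<open>n\<close> and rests before and after.
\<close>

lemma loops_winding_nonempty:
  assumes "k \<ge> 3"
  obtains f where "f \<in> loops_winding k n"
proof -
  define N where "N = k * \<bar>n\<bar>"
  have "N \<ge> 0" using assms by (simp add: N_def)
  define F where "F i = sgn n * max 0 (min i N)" for i
  let ?f = "\<lambda>i. F i mod k"
  have F: "is_lift k F ?f"
    by (cases n "0 :: int" rule: linorder_cases) (auto simp: is_lift_def F_def)
  have st: "stable_above ?f N" "stable_below ?f 0"
    by (auto simp: stable_above_def stable_below_def F_def)
  have FN: "F N = k * n" "F 0 = 0"
    using \<open>N \<ge> 0\<close> by (auto simp: F_def N_def sgn_mult_abs mult.left_commute)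
  have "?f \<in> B1 (cycle_graph k) 0"
    unfolding B1_iff[OF st] using lift_imp_hom[OF _ F] FN assms by simp
  moreover have "displacement k ?f = k * n"
    using displacement_eq[OF assms F st] FN by simp
  ultimately show thesis using that by (auto simp: loops_winding_def)
qed

text \<open>
  Lifts \<open>F\<close> of \<open>f\<close> and \<open>G\<close> of \<open>g\<close> are glued: on the negative side \<open>G\<close> is reindexed as in the
  concatenation, on the other side \<open>F\<close> is reindexed and raised so that the values at \<open>0\<close> match.
\<close>

lemma loops_winding_concat:
  assumes "k \<ge> 3" and f: "f \<in> loops_winding k m" and g: "g \<in> loops_winding k n"
  shows "path_concat f g \<in> loops_winding k (m + n)"
proof -
  from f have "f \<in> B1 (cycle_graph k) 0" by (simp add: loops_winding_def)
  from B1_lift[OF assms(1) this] obtain F where F: "is_lift k F f"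
    and stf: "stable_above f (pos_index f)" "stable_below f (neg_index f)"
    and f0: "f (pos_index f) = 0" "f (neg_index f) = 0"
    and df: "displacement k f = F (pos_index f) - F (neg_index f)" by metis
  from g have "g \<in> B1 (cycle_graph k) 0" by (simp add: loops_winding_def)
  from B1_lift[OF assms(1) this] obtain G where G: "is_lift k G g"
    and stg: "stable_above g (pos_index g)" "stable_below g (neg_index g)"
    and g0: "g (pos_index g) = 0" "g (neg_index g) = 0"
    and dg: "displacement k g = G (pos_index g) - G (neg_index g)" by metis
  \<comment> \<open>both terms are multiples of \<open>k\<close>, so raising \<open>F\<close> by \<open>c\<close> does not change its projection\<close>
  define c where "c = G (pos_index g) - F (neg_index f)"
  have c: "c mod k = 0"
    using F G f0 g0 by (simp add: is_lift_def c_def mod_eq_dvd_iff[symmetric] mod_0_imp_dvd dvd_diff)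
  define C where "C i = (if i \<ge> 0 then F (i + neg_index f) + c else G (i + pos_index g))" for i
  have C_mod: "C i mod k = path_concat f g i" for i
  proof -
    have "(z + c) mod k = z mod k" for z using c by (metis add.right_neutral mod_add_right_eq)
    then show ?thesis using F G by (simp add: C_def path_concat_def is_lift_def)
  qed
  have "\<bar>C (i + 1) - C i\<bar> \<le> 1" for i
  proof -
    consider "i \<ge> 0" | "i = -1" | "i < -1" by linarith
    then show ?thesis
    proof cases
      case 1
      with F[unfolded is_lift_def, THEN conjunct1, rule_format, of "i + neg_index f"]
      show ?thesis by (simp add: C_def algebra_simps)
    next
      case 2
      have "\<bar>G (pos_index g - 1 + 1) - G (pos_index g - 1)\<bar> \<le> 1"
        using G unfolding is_lift_def by blast
      then show ?thesis using 2 by (simp add: C_def c_def add.commute)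
    next
      case 3
      with G[unfolded is_lift_def, THEN conjunct1, rule_format, of "i + pos_index g"]
      show ?thesis by (simp add: C_def algebra_simps)
    qed
  qed
  with C_mod have C: "is_lift k C (path_concat f g)" by (simp add: is_lift_def)
  define p where "p = max 0 (pos_index f - neg_index f)"
  \<comment> \<open>\<open>-1\<close> rather than \<open>0\<close>: at \<open>0\<close> the concatenation already takes its value from \<open>f\<close>\<close>
  define q where "q = min (-1) (neg_index g - pos_index g)"
  have above: "path_concat f g m = 0" if "m \<ge> p" for m
    using that stable_aboveD[OF stf(1), of "m + neg_index f"] f0(1)
    by (simp add: path_concat_def p_def)
  have below: "path_concat f g m = 0" if "m \<le> q" for m
    using that stable_belowD[OF stg(2), of "m + pos_index g"] g0(2)
    by (simp add: path_concat_def q_def)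
  have st: "stable_above (path_concat f g) p" "stable_below (path_concat f g) q"
    by (simp_all add: stable_above_def stable_below_def above below)
  have "stable_above F (pos_index f)" "stable_below G (neg_index g)"
    using lift_stable_above[OF _ F stf(1)] lift_stable_below[OF _ G stg(2)] assms(1) by simp_all
  from stable_aboveD[OF this(1), of "p + neg_index f"] stable_belowD[OF this(2), of "q + pos_index g"]
  have lim: "C p = F (pos_index f) + c" "C q = G (neg_index g)"
    by (simp_all add: C_def p_def q_def)
  have "path_concat f g p = 0" "path_concat f g q = 0"
    using above below by simp_all
  then have "path_concat f g \<in> B1 (cycle_graph k) 0"
    unfolding B1_iff[OF st] using lift_imp_hom[OF _ C] assms(1) by simp
  moreover have "displacement k (path_concat f g) = displacement k f + displacement k g"
    using displacement_eq[OF assms(1) C st] lim df dg by (simp add: c_def)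
  ultimately show ?thesis using f g by (simp add: loops_winding_def algebra_simps)
qed

lemma const_in_loops_winding:
  assumes "k \<ge> 3"
  shows "(\<lambda>_. 0) \<in> loops_winding k 0"
proof -
  have F: "is_lift k (\<lambda>_. 0) (\<lambda>_. 0)" by (simp add: is_lift_def)
  have st: "stable_above (\<lambda>_. 0 :: int) 0" "stable_below (\<lambda>_. 0 :: int) 0"
    by (auto simp: stable_above_def stable_below_def)
  show ?thesis
    using B1_iff[OF st] lift_imp_hom[OF _ F] displacement_eq[OF assms F st] assms
    by (simp add: loops_winding_def)
qed

lemma loops_winding_iso:
  assumes "k \<ge> 5"
  shows "loops_winding k \<in> iso integer_group (A1 (cycle_graph k) 0)"
proof -
  have k3: "k \<ge> 3" using assms by simp
  let ?A = "A1 (cycle_graph k) 0"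
  have carrier: "carrier ?A = range (loops_winding k)"
  proof (intro equalityI subsetI)
    fix a assume "a \<in> carrier ?A"
    then obtain f where f: "f \<in> B1 (cycle_graph k) 0" "a = path_homotopy (cycle_graph k) `` {f}"
      by (auto simp: A1_def quotient_def)
    then show "a \<in> range (loops_winding k)"
      using B1_in_loops_winding[OF k3 f(1)] path_homotopy_class[OF assms] by (metis rangeI)
  next
    fix a assume "a \<in> range (loops_winding k)"
    then obtain n where n: "a = loops_winding k n" by blast
    obtain f where f: "f \<in> loops_winding k n" using loops_winding_nonempty[OF k3] by blast
    then have "f \<in> B1 (cycle_graph k) 0" by (simp add: loops_winding_def)
    then show "a \<in> carrier ?A"
      using path_homotopy_class[OF assms f] n by (auto simp: A1_def quotient_def)
  qed
  have mult: "loops_winding k (m + n) = loops_winding k m \<otimes>\<^bsub>?A\<^esub> loops_winding k n" for m n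
  proof -
    have "path_homotopy (cycle_graph k) `` {path_concat f g} = loops_winding k (m + n)"
      if "f \<in> loops_winding k m" "g \<in> loops_winding k n" for f g
      using path_homotopy_class[OF assms loops_winding_concat[OF k3 that]] .
    moreover obtain f g where "f \<in> loops_winding k m" "g \<in> loops_winding k n"
      using loops_winding_nonempty[OF k3] by metis
    ultimately show ?thesis unfolding A1_def by auto
  qed
  have "inj (loops_winding k)"
  proof (rule injI)
    fix m n assume eq: "loops_winding k m = loops_winding k n"
    obtain f where "f \<in> loops_winding k m" using loops_winding_nonempty[OF k3] by blast
    moreover from this have "f \<in> loops_winding k n" using eq by simp
    ultimately have "k * m = k * n" by (simp add: loops_winding_def)
    then show "m = n" using assms by simp
  qed
  with carrier mult show ?thesis
    by (intro isoI homI) (auto simp: integer_group_def bij_betw_def)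
qed

text \<open>
  The isomorphism from \<open>\<int>\<close> carries the group structure to its image, so the group axioms of
  \<open>A\<^sub>1\<close> do not have to be checked on representatives; only the unit must be identified.
\<close>

theorem proposition4p0p7:
  fixes k :: int
  assumes "k \<ge> 5"
  shows "group (A1 (cycle_graph k) 0) \<and> A1 (cycle_graph k) 0 \<cong> integer_group"
proof
  let ?A = "A1 (cycle_graph k) 0"
  have iso: "loops_winding k \<in> iso integer_group ?A"
    using assms by (rule loops_winding_iso)
  have "group (?A\<lparr>one := loops_winding k \<one>\<^bsub>integer_group\<^esub>\<rparr>)"
    using group.iso_imp_img_group[OF group_integer_group iso] .
  moreover have "loops_winding k \<one>\<^bsub>integer_group\<^esub> = \<one>\<^bsub>?A\<^esub>"
    using path_homotopy_class[OF assms const_in_loops_winding] assms by (simp add: A1_def)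
  ultimately show "group ?A" by simp
  have "integer_group \<cong> ?A" using iso by (auto simp: is_iso_def)
  then show "?A \<cong> integer_group"
    by (rule group.iso_sym[OF group_integer_group])
qed

end
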